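(* Let $f:\mathbb{R}^n\to\mathbb{R}$ be differentiable and bounded from below, $f(x)\ge f^*$ for all $x\in\mathbb{R}^n$, and $L$-smooth with $L>0$, i.e. $\|\nabla f(x)-\nabla f(y)\|\le L\|x-y\|$ for all $x,y\in\mathbb{R}^n$. Assume that $$0<\alpha<\frac1L,\qquad 0\le\beta\le\sqrt{1-\alpha L}.$$ Then for any initial conditions $x_0,x_1\in\mathbb{R}^n$, with iterates defined by the Heavy Ball method $$x_{k+1}=x_k-\alpha\nabla f(x_k)+\beta(x_k-x_{k-1}),\qquad k\ge1,$$ the quantity $$V_k=f(x_k)-f^*+\frac{1-\alpha L}{2\alpha}\|x_k-x_{k-1}\|^2,\qquad k\ge1,$$ is a Lyapunov function for the method, that is, $V_k\le V_{k-1}$ for all $k\ge2$.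
   Context: $\|\cdot\|$ is the Euclidean norm on $\mathbb{R}^n$. No convexity of $f$ is assumed. *)

theory Defs
  imports "HOL-Analysis.Analysis"
begin

text \<open>
  The argument \<open>g\<close> is the gradient of the objective, \<open>\<alpha>\<close> the step size and \<open>\<beta>\<close> the momentum
  parameter. The values \<open>x 0\<close> and \<open>x 1\<close> are unconstrained: they are the initial conditions.
  In both definitions below, \<open>k - 1\<close> is natural-number subtraction and is only meant for \<open>k \<ge> 1\<close>.
\<close>

definition heavy_ball ::
  "('a::real_inner \<Rightarrow> 'a) \<Rightarrow> real \<Rightarrow> real \<Rightarrow> (nat \<Rightarrow> 'a) \<Rightarrow> bool"
where
  "heavy_ball g \<alpha> \<beta> x \<longleftrightarrow>
     (\<forall>k\<ge>1. x (k + 1) = x k - \<alpha> *\<^sub>R g (x k) + \<beta> *\<^sub>R (x k - x (k - 1)))"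

definition heavy_ball_V ::
  "('a::real_inner \<Rightarrow> real) \<Rightarrow> real \<Rightarrow> real \<Rightarrow> real \<Rightarrow> (nat \<Rightarrow> 'a) \<Rightarrow> nat \<Rightarrow> real"
where
  "heavy_ball_V f f_star L \<alpha> x k =
     f (x k) - f_star + (1 - \<alpha> * L) / (2 * \<alpha>) * (norm (x k - x (k - 1)))\<^sup>2"

end

theory Submission
  imports Defs
begin

text \<open>
  Write \<open>d = x\<^sub>k - x\<^sub>k\<^sub>-\<^sub>1\<close> and \<open>e = x\<^sub>k\<^sub>+\<^sub>1 - x\<^sub>k\<close> for two consecutive displacements and \<open>g\<close> for the
  gradient at \<open>x\<^sub>k\<close>, so that \<open>e + \<alpha> g = \<beta> d\<close>. By \<open>L\<close>-smoothness (lemma \<open>descent_lemma\<close>) a step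
  changes the objective by at most \<open>g \<bullet> e + L/2 |e|\<^sup>2\<close>. The weight \<open>(1 - \<alpha> L)/(2 \<alpha>)\<close> of the
  kinetic term is chosen so that adding its new value \<open>(1 - \<alpha> L)/(2 \<alpha>) |e|\<^sup>2\<close> cancels the \<open>L\<close>-term
  and leaves
  \<open>g \<bullet> e + |e|\<^sup>2/(2 \<alpha>) = (|e + \<alpha> g|\<^sup>2 - \<alpha>\<^sup>2 |g|\<^sup>2)/(2 \<alpha>) = \<beta>\<^sup>2/(2 \<alpha>) |d|\<^sup>2 - \<alpha>/2 |g|\<^sup>2\<close>.
  The bound \<open>\<beta>\<^sup>2 \<le> 1 - \<alpha> L\<close> is exactly what makes the old value \<open>(1 - \<alpha> L)/(2 \<alpha>) |d|\<^sup>2\<close> of the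
  kinetic term pay for the first summand; hence every step decreases the Lyapunov function by at
  least \<open>\<alpha>/2 |g|\<^sup>2\<close> (lemma \<open>heavy_ball_step_decrease\<close>).
\<close>

text \<open>
  Along the segment from \<open>y\<close> to \<open>y + v\<close>, the gap between \<open>f\<close> and its quadratic upper model has
  slope \<open>(\<nabla>f (y + t v) - \<nabla>f y) \<bullet> v - L t |v|\<^sup>2\<close>, which is nonpositive by Cauchy-Schwarz and the
  Lipschitz bound. So the gap is no larger at \<open>t = 1\<close> than at \<open>t = 0\<close>, where \<open>f\<close> and the model agree.
\<close>

lemma descent_lemma:
  fixes f :: "'a::real_inner \<Rightarrow> real"
  assumes grad: "\<And>y. GDERIV f y :> g y"
    and lip: "\<And>y z. norm (g y - g z) \<le> L * norm (y - z)"
  shows "f (y + v) \<le> f y + g y \<bullet> v + L / 2 * (norm v)\<^sup>2"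
proof -
  define gap where "gap t = f (y + t *\<^sub>R v) - f y - t * (g y \<bullet> v) - L / 2 * t\<^sup>2 * (norm v)\<^sup>2" for t
  have f_line: "((\<lambda>t. f (y + t *\<^sub>R v)) has_real_derivative g (y + t *\<^sub>R v) \<bullet> v) (at t)" for t
  proof -
    have line: "((\<lambda>t. y + t *\<^sub>R v) has_derivative (\<lambda>s. s *\<^sub>R v)) (at t)"
      by (auto intro!: derivative_eq_intros)
    have "(f has_derivative (\<lambda>h. h \<bullet> g (y + t *\<^sub>R v))) (at (y + t *\<^sub>R v))"
      using grad by (simp add: gderiv_def)
    from has_derivative_compose[OF line this] show ?thesis
      by (simp add: has_field_derivative_def inner_commute mult_commute_abs)
  qed
  have gap_deriv: "(gap has_real_derivative
      (g (y + t *\<^sub>R v) - g y) \<bullet> v - L * t * (norm v)\<^sup>2) (at t)" for t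
    unfolding gap_def
    by (rule derivative_eq_intros f_line refl | simp add: inner_diff_left)+
  have slope: "(g (y + t *\<^sub>R v) - g y) \<bullet> v - L * t * (norm v)\<^sup>2 \<le> 0" if "0 \<le> t" for t
  proof -
    have "(g (y + t *\<^sub>R v) - g y) \<bullet> v \<le> norm (g (y + t *\<^sub>R v) - g y) * norm v"
      by (rule norm_cauchy_schwarz)
    also have "\<dots> \<le> L * norm (t *\<^sub>R v) * norm v"
      using lip[of "y + t *\<^sub>R v" y] by (intro mult_right_mono) auto
    also have "\<dots> = L * t * (norm v)\<^sup>2"
      using that by (simp add: power2_eq_square)
    finally show ?thesis by simp
  qed
  have "gap 1 \<le> gap 0"
    using gap_deriv slope by (intro DERIV_nonpos_imp_nonincreasing[of 0 1 gap]) fastforce+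
  then show ?thesis
    by (simp add: gap_def)
qed

lemma heavy_ball_step_decrease:
  fixes f :: "'a::real_inner \<Rightarrow> real"
  assumes grad: "\<And>y. GDERIV f y :> g y"
    and lip: "\<And>y z. norm (g y - g z) \<le> L * norm (y - z)"
    and \<alpha>: "0 < \<alpha>" and \<beta>: "\<beta>\<^sup>2 \<le> 1 - \<alpha> * L"
    and hb: "heavy_ball g \<alpha> \<beta> x" and k: "1 \<le> k"
  shows "heavy_ball_V f f_star L \<alpha> x (k + 1)
           \<le> heavy_ball_V f f_star L \<alpha> x k - \<alpha> / 2 * (norm (g (x k)))\<^sup>2"
proof -
  define d e G where "d = x k - x (k - 1)" and "e = x (k + 1) - x k" and "G = g (x k)"
  have momentum: "e + \<alpha> *\<^sub>R G = \<beta> *\<^sub>R d"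
    using hb k by (simp add: heavy_ball_def d_def e_def G_def)
  have descent: "f (x (k + 1)) \<le> f (x k) + G \<bullet> e + L / 2 * (norm e)\<^sup>2"
    using descent_lemma[OF grad lip, of "x k" e] by (simp add: e_def G_def)
  have square: "(norm (e + \<alpha> *\<^sub>R G))\<^sup>2 = (norm e)\<^sup>2 + 2 * \<alpha> * (G \<bullet> e) + \<alpha>\<^sup>2 * (norm G)\<^sup>2"
    unfolding power2_norm_eq_inner
    by (simp add: inner_add inner_commute algebra_simps power2_eq_square)
  have "G \<bullet> e + L / 2 * (norm e)\<^sup>2 + (1 - \<alpha> * L) / (2 * \<alpha>) * (norm e)\<^sup>2
      = G \<bullet> e + (norm e)\<^sup>2 / (2 * \<alpha>)"
    using \<alpha> by (simp add: field_simps)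
  also have "\<dots> = ((norm (e + \<alpha> *\<^sub>R G))\<^sup>2 - \<alpha>\<^sup>2 * (norm G)\<^sup>2) / (2 * \<alpha>)"
    unfolding square using \<alpha> by (simp add: field_simps)
  also have "\<dots> = \<beta>\<^sup>2 / (2 * \<alpha>) * (norm d)\<^sup>2 - \<alpha> / 2 * (norm G)\<^sup>2"
    unfolding momentum using \<alpha> by (simp add: power_mult_distrib field_simps power2_eq_square)
  also have "\<dots> \<le> (1 - \<alpha> * L) / (2 * \<alpha>) * (norm d)\<^sup>2 - \<alpha> / 2 * (norm G)\<^sup>2"
    using \<alpha> \<beta> by (intro diff_right_mono mult_right_mono divide_right_mono) auto
  finally show ?thesis
    using descent unfolding heavy_ball_V_def add_diff_cancel_right' d_def e_def G_def by linarith
qed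

theorem theorem2:
  fixes f :: "real ^ 'n \<Rightarrow> real"
    and grad_f :: "real ^ 'n \<Rightarrow> real ^ 'n"
    and x :: "nat \<Rightarrow> real ^ 'n"
    and f_star L \<alpha> \<beta> :: real
  assumes "\<And>y. GDERIV f y :> grad_f y"
    and "\<And>y. f y \<ge> f_star"
    and "L > 0"
    and "\<And>y z. norm (grad_f y - grad_f z) \<le> L * norm (y - z)"
    and "0 < \<alpha>" and "\<alpha> < 1 / L"
    and "0 \<le> \<beta>" and "\<beta> \<le> sqrt (1 - \<alpha> * L)"
    and "heavy_ball grad_f \<alpha> \<beta> x"
  shows "\<forall>k\<ge>2. heavy_ball_V f f_star L \<alpha> x k \<le> heavy_ball_V f f_star L \<alpha> x (k - 1)"
proof (intro allI impI)
  fix k :: nat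
  assume k: "2 \<le> k"
  have "0 \<le> 1 - \<alpha> * L"
    using \<open>L > 0\<close> \<open>\<alpha> < 1 / L\<close> by (simp add: field_simps)
  then have "\<beta>\<^sup>2 \<le> 1 - \<alpha> * L"
    using power_mono[OF \<open>\<beta> \<le> sqrt (1 - \<alpha> * L)\<close> \<open>0 \<le> \<beta>\<close>, of 2] by simp
  with assms k have "heavy_ball_V f f_star L \<alpha> x (k - 1 + 1)
      \<le> heavy_ball_V f f_star L \<alpha> x (k - 1) - \<alpha> / 2 * (norm (grad_f (x (k - 1))))\<^sup>2"
    by (intro heavy_ball_step_decrease) auto
  also have "\<dots> \<le> heavy_ball_V f f_star L \<alpha> x (k - 1)"
    using \<open>0 < \<alpha>\<close> by simp
  finally show "heavy_ball_V f f_star L \<alpha> x k \<le> heavy_ball_V f f_star L \<alpha> x (k - 1)"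
    using k by simp
qed

end
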